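(* Let $A_\eta(n)=\sum_{k=0}^{n}(-1)^k\binom{n}{k}^3\binom{4n-5k}{3n}$ for $n\ge0$. For any prime $p\ne3$, $$A_\eta\!\left(\left\lfloor \tfrac{p}{3}\right\rfloor\right)\equiv\begin{cases}(-1)^{\lfloor p/5\rfloor}\binom{\lfloor p/3\rfloor}{\lfloor p/15\rfloor}^3, & \text{if } p\equiv1,2,4,8\pmod{15},\\ 0, & \text{otherwise},\end{cases}\pmod p.$$
   Context: For integers $m\ge0$ and any number $x$, $\binom{x}{m}=\frac{x(x-1)\cdots(x-m+1)}{m!}$ (so the upper entry $4n-5k$ may be negative). Equivalently, $A_\eta(0)=1$ and, for $n\ge1$, $A_\eta(n)=\sum_{k=0}^{\lfloor n/5\rfloor}(-1)^k\binom{n}{k}^3\bigl(\binom{4n-5k-1}{3n}+\binom{4n-5k}{3n}\bigr)$. *)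

theory Defs
  imports Complex_Main "HOL-Number_Theory.Number_Theory"
begin

text \<open>
  The binomial coefficient with an arbitrary integer (possibly negative) upper entry. The right-hand
  side is the definition of \<open>gchoose\<close> at type \<^typ>\<open>int\<close>. It is written out because the type
  constraint on \<open>gchoose\<close> (all of \<^class>\<open>semidom_divide\<close> or only fields) depends on the order in
  which theories are merged, so that \<open>gchoose\<close> cannot be used reliably on \<^typ>\<open>int\<close> here.
\<close>

definition int_binomial_coeff :: "int \<Rightarrow> nat \<Rightarrow> int" where
  "int_binomial_coeff x m = (\<Prod>i=0..<m. x - int i) div fact m"

text \<open>The division is exact:\<close>

lemma of_int_int_binomial_coeff:
  "of_int (int_binomial_coeff x m) = (of_int x :: 'a :: field_char_0) gchoose m"
  unfolding int_binomial_coeff_def of_int_gbinomial[symmetric]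
  by (simp only: gbinomial_prod_rev)

lemma int_binomial_coeff_of_nat: "int_binomial_coeff (int n) m = int (n choose m)"
  unfolding int_binomial_coeff_def int_binomial by (simp only: gbinomial_prod_rev)

definition A_eta :: "nat \<Rightarrow> int" where
  "A_eta n = (\<Sum>k=0..n. (-1) ^ k * int (n choose k) ^ 3
                * int_binomial_coeff (4 * int n - 5 * int k) (3 * n))"

end

theory Submission
  imports Defs
begin

text \<open>
  Put \<open>n = \<lfloor>p/3\<rfloor>\<close>. Modulo \<open>p\<close> the coefficient of \<open>x\<close> over \<open>3n < p\<close> depends only on the residue of
  \<open>x\<close>, and it vanishes when that residue is below \<open>3n\<close>. As \<open>p \<le> 3n + 2\<close>, only residues \<open>-1\<close>
  and \<open>-2\<close> survive, so that in the sum only \<open>k\<close> with \<open>5k\<close> in \<open>{n, 4n + 1}\<close> (\<open>p = 3n + 1\<close>) or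
  in \<open>{n - 1, n, 4n + 1, 4n + 2}\<close> (\<open>p = 3n + 2\<close>) matter. Divisibility by 5 leaves at most one
  such \<open>k\<close>, except for \<open>p = 5\<close>.
\<close>

text \<open>Clears the exact division in the definition, so that congruences between the products
  can be carried over to the coefficients.\<close>

lemma fact_mult_int_binomial_coeff:
  "fact m * int_binomial_coeff x m = (\<Prod>i=0..<m. x - int i)"
proof -
  have "real_of_int (fact m * int_binomial_coeff x m) = real_of_int (\<Prod>i=0..<m. x - int i)"
    by (simp add: of_int_int_binomial_coeff gbinomial_prod_rev)
  then show ?thesis
    by (simp only: of_int_eq_iff)
qed

text \<open>Since \<open>m < p\<close>, the factor \<open>fact m\<close> is invertible modulo
  \<open>p\<close> and can be cancelled.\<close>

lemma cong_int_binomial_coeff: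
  assumes "prime p" "m < p" "[x = y] (mod int p)"
  shows "[int_binomial_coeff x m = int_binomial_coeff y m] (mod int p)"
proof -
  have "coprime (fact m :: nat) p"
    using assms by (metis coprime_commute not_le prime_dvd_fact_iff prime_imp_coprime)
  then have "coprime (fact m :: int) (int p)"
    by (metis coprime_int_iff of_nat_fact)
  moreover have "[fact m * int_binomial_coeff x m = fact m * int_binomial_coeff y m] (mod int p)"
    unfolding fact_mult_int_binomial_coeff using assms(3)
    by (intro cong_prod cong_diff) auto
  ultimately show ?thesis
    by (simp add: cong_mult_lcancel)
qed

lemma prime_dvd_int_binomial_coeff:
  assumes "prime p" "m < p" "x mod int p < int m"
  shows "int p dvd int_binomial_coeff x m"
proof -
  have "p > 0"
    using assms(1) by (simp add: prime_gt_0_nat)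
  then obtain r where r: "x mod int p = int r"
    by (metis nonneg_int_cases of_nat_0_less_iff pos_mod_sign)
  have "[int_binomial_coeff x m = int_binomial_coeff (int r) m] (mod int p)"
    by (intro cong_int_binomial_coeff assms) (simp add: cong_def flip: r)
  moreover have "int_binomial_coeff (int r) m = 0"
    using r assms(3) by (simp add: int_binomial_coeff_of_nat)
  ultimately show ?thesis
    by (simp add: cong_0_iff)
qed

lemma A_eta_cong_0:
  assumes "prime p" "3 * n < p"
    and "\<And>k. k \<le> n \<Longrightarrow> (4 * int n - 5 * int k) mod int p < 3 * int n"
  shows "[A_eta n = 0] (mod int p)"
  unfolding A_eta_def cong_0_iff using assms
  by (intro dvd_sum dvd_mult prime_dvd_int_binomial_coeff) auto

text \<open>The congruence on \<open>j\<close> makes the upper entry of its term congruent to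
  \<open>3 * n\<close>, so the coefficient becomes 1; all other terms vanish modulo
  \<open>p\<close>.\<close>

lemma A_eta_cong_single_term:
  assumes "prime p" "3 * n < p" "j \<le> n" "[5 * int j = int n] (mod int p)"
    and "\<And>k. k \<le> n \<Longrightarrow> k \<noteq> j \<Longrightarrow> (4 * int n - 5 * int k) mod int p < 3 * int n"
  shows "[A_eta n = (-1) ^ j * int (n choose j) ^ 3] (mod int p)"
proof -
  let ?f = "\<lambda>k. (-1) ^ k * int (n choose k) ^ 3
    * int_binomial_coeff (4 * int n - 5 * int k) (3 * n)"
  have "A_eta n = ?f j + (\<Sum>k\<in>{0..n} - {j}. ?f k)"
    unfolding A_eta_def using assms(3) by (intro sum.remove) auto
  moreover have "[(\<Sum>k\<in>{0..n} - {j}. ?f k) = 0] (mod int p)"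
    unfolding cong_0_iff using assms
    by (intro dvd_sum dvd_mult prime_dvd_int_binomial_coeff) auto
  from cong_add[OF cong_refl this, of "?f j"]
  have "[?f j + (\<Sum>k\<in>{0..n} - {j}. ?f k) = ?f j] (mod int p)"
    by (simp only: add_0_right)
  ultimately have "[A_eta n = ?f j] (mod int p)"
    by (simp only:)
  moreover have "[4 * int n - 5 * int j = int (3 * n)] (mod int p)"
    using cong_diff[OF cong_refl assms(4), of "4 * int n"] by simp
  then have "[int_binomial_coeff (4 * int n - 5 * int j) (3 * n) =
      int_binomial_coeff (int (3 * n)) (3 * n)] (mod int p)"
    by (intro cong_int_binomial_coeff assms)
  then have "[?f j = (-1) ^ j * int (n choose j) ^ 3 * 1] (mod int p)"
    unfolding int_binomial_coeff_of_nat by (intro cong_mult cong_refl) simp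
  ultimately show ?thesis
    unfolding mult_1_right by (rule cong_trans)
qed

text \<open>For \<open>k \<le> n\<close> the upper entry lies between \<open>- n\<close> and
  \<open>4 * n\<close>, so its residue is reached by at most one shift by \<open>p\<close>.\<close>

lemma mod_ge_cases:
  fixes n k p :: nat
  assumes "p = 3 * n + 1 \<or> p = 3 * n + 2" "k \<le> n"
    and "\<not> (4 * int n - 5 * int k) mod int p < 3 * int n"
  shows "5 * k = n \<or> 5 * k = 4 * n + 1 \<or>
    (p = 3 * n + 2 \<and> (5 * k + 1 = n \<or> 5 * k = 4 * n + 2))"
proof -
  let ?x = "4 * int n - 5 * int k"
  consider "?x < 0" | "0 \<le> ?x" "?x < int p" | "int p \<le> ?x"
    by linarith
  then show ?thesis
  proof cases
    case 1
    have "?x mod int p = (?x + int p) mod int p"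
      by simp
    also have "\<dots> = ?x + int p"
      using 1 assms(1,2) by (intro mod_pos_pos_trivial) auto
    finally show ?thesis
      using 1 assms by auto
  next
    case 2
    then have "?x mod int p = ?x"
      by (intro mod_pos_pos_trivial)
    then show ?thesis
      using 2 assms by auto
  next
    \<comment> \<open>Here the shifted entry is at most \<open>4 * n - p\<close>, which is below
      \<open>3 * n\<close>, contrary to the assumption on the residue.\<close>
    case 3
    have "?x mod int p = (?x - int p) mod int p"
      by simp
    also have "\<dots> = ?x - int p"
      using 3 assms(1,2) by (intro mod_pos_pos_trivial) auto
    finally show ?thesis
      using 3 assms by auto
  qed
qed

lemma prime_mod_15_cases:
  fixes p :: nat
  assumes "prime p" "p \<noteq> 3" "p \<noteq> 5"
  shows "p mod 15 \<in> {1, 2, 4, 7, 8, 11, 13, 14}"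
proof -
  have "\<not> 3 dvd p" "\<not> 5 dvd p"
    using assms primes_dvd_imp_eq[of 3 p] primes_dvd_imp_eq[of 5 p] by auto
  then have "p mod 3 \<noteq> 0" "p mod 5 \<noteq> 0"
    by (simp_all add: dvd_eq_mod_eq_0)
  then show ?thesis
    unfolding insert_iff empty_iff by presburger
qed

lemma A_eta_1: "A_eta 1 = 5"
proof -
  have "{0..<3} = {0, 1, 2 :: nat}"
    by auto
  then show ?thesis
    by (simp add: A_eta_def int_binomial_coeff_def fact_numeral)
qed

theorem theorem6p4:
  fixes p :: nat
  assumes "prime p" and "p \<noteq> 3"
  shows "[A_eta (p div 3) =
           (if p mod 15 \<in> {1, 2, 4, 8}
            then (-1) ^ (p div 5) * int ((p div 3) choose (p div 15)) ^ 3
            else 0)] (mod int p)"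
proof (cases "p = 5")
  \<comment> \<open>For \<open>p = 5\<close> both terms, \<open>k = 0\<close> and
    \<open>k = 1\<close>, survive, but they are 4 and 1 and cancel modulo 5.\<close>
  case True
  then show ?thesis
    using A_eta_1 by (simp add: cong_def)
next
  case False
  define n where "n = p div 3"
  define m where "m = p div 15"
  define r where "r = p mod 15"
  have p: "p = 15 * m + r"
    by (simp add: m_def r_def)
  have r: "r \<in> {1, 2, 4, 7, 8, 11, 13, 14}"
    using prime_mod_15_cases[OF assms False] by (simp add: r_def)
  have "\<not> 3 dvd p"
    using assms primes_dvd_imp_eq[of 3 p] by auto
  then have n: "p = 3 * n + 1 \<or> p = 3 * n + 2"
    unfolding n_def by presburger
  then have "3 * n < p"
    by auto
  note single = A_eta_cong_single_term[OF assms(1) \<open>3 * n < p\<close>]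
  consider "r = 1 \<or> r = 2" | "r = 4" | "r = 8" | "r \<in> {7, 11, 13, 14}"
    using r by auto
  then have "[A_eta n = (if r \<in> {1, 2, 4, 8} then (-1) ^ (p div 5) * int (n choose m) ^ 3 else 0)]
    (mod int p)"
  proof cases
    case 1
    then have n5: "n = 5 * m" and p5: "p div 5 = 3 * m"
      using p by (auto simp: n_def)
    have "[A_eta n = (-1) ^ m * int (n choose m) ^ 3] (mod int p)"
    proof (rule single)
      fix k assume "k \<le> n" "k \<noteq> m"
      show "(4 * int n - 5 * int k) mod int p < 3 * int n"
      proof (rule ccontr)
        assume "\<not> ?thesis"
        from mod_ge_cases[OF n \<open>k \<le> n\<close> this] show False
          using \<open>k \<noteq> m\<close> n5 by auto presburger+
      qed
    qed (use n5 in auto)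
    then show ?thesis
      using 1 by (auto simp: p5 power_mult)
  next
    case 2
    then have n5: "n = 5 * m + 1" and p5: "p div 5 = 3 * m"
      using p by (auto simp: n_def)
    \<comment> \<open>Needed to exclude \<open>5 * k + 1 = n\<close>, which would be solved by
      \<open>k = m\<close>.\<close>
    have pn: "p = 3 * n + 1"
      using p 2 n5 by simp
    have "odd p"
      using p 2 assms(1) by (intro prime_odd_nat) auto
    then have "odd m"
      using p 2 by simp
    \<comment> \<open>The surviving index solves \<open>5 * k = 4 * n + 1\<close>; then
      \<open>5 * k - n = p\<close>.\<close>
    have "[A_eta n = (-1) ^ (4 * m + 1) * int (n choose (4 * m + 1)) ^ 3] (mod int p)"
    proof (rule single)
      show "[5 * int (4 * m + 1) = int n] (mod int p)"
        using p 2 n5 by (simp add: cong_iff_dvd_diff add.commute)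
      fix k assume "k \<le> n" "k \<noteq> 4 * m + 1"
      show "(4 * int n - 5 * int k) mod int p < 3 * int n"
      proof (rule ccontr)
        assume "\<not> ?thesis"
        from mod_ge_cases[OF n \<open>k \<le> n\<close> this] show False
          using \<open>k \<noteq> 4 * m + 1\<close> n5 pn by auto presburger+
      qed
    qed (use n5 in auto)
    \<comment> \<open>Symmetry restores the lower entry \<open>m\<close>. As \<open>m\<close> is
      odd, \<open>4 * m + 1\<close> and \<open>3 * m\<close> have the same parity, so the signs
      agree.\<close>
    moreover have "n choose (4 * m + 1) = n choose m"
      using binomial_symmetric[of m n] n5 by simp
    ultimately show ?thesis
      using 2 \<open>odd m\<close> by (simp add: p5)
  next
    case 3
    then have n5: "n = 5 * m + 2" and p5: "p div 5 = 3 * m + 1"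
      using p by (auto simp: n_def)
    have "odd p"
      using p 3 assms(1) by (intro prime_odd_nat) auto
    then have "odd m"
      using p 3 by simp
    \<comment> \<open>Now the index solves \<open>5 * k = 4 * n + 2\<close>, again with
      \<open>5 * k - n = p\<close>.\<close>
    have "[A_eta n = (-1) ^ (4 * m + 2) * int (n choose (4 * m + 2)) ^ 3] (mod int p)"
    proof (rule single)
      show "[5 * int (4 * m + 2) = int n] (mod int p)"
        using p 3 n5 by (simp add: cong_iff_dvd_diff add.commute)
      fix k assume "k \<le> n" "k \<noteq> 4 * m + 2"
      show "(4 * int n - 5 * int k) mod int p < 3 * int n"
      proof (rule ccontr)
        assume "\<not> ?thesis"
        from mod_ge_cases[OF n \<open>k \<le> n\<close> this] show False
          using \<open>k \<noteq> 4 * m + 2\<close> n5 by auto presburger+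
      qed
    qed (use n5 in auto)
    moreover have "n choose (4 * m + 2) = n choose m"
      using binomial_symmetric[of m n] n5 by simp
    ultimately show ?thesis
      using 3 \<open>odd m\<close> by (simp add: p5)
  next
    case 4
    \<comment> \<open>For these \<open>r\<close>, none of the candidate equations for
      \<open>5 * k\<close> is solvable modulo 5.\<close>
    have "[A_eta n = 0] (mod int p)"
    proof (rule A_eta_cong_0[OF assms(1) \<open>3 * n < p\<close>])
      fix k assume "k \<le> n"
      show "(4 * int n - 5 * int k) mod int p < 3 * int n"
      proof (rule ccontr)
        assume "\<not> ?thesis"
        from mod_ge_cases[OF n \<open>k \<le> n\<close> this] show False
          using 4 p n by auto presburger+
      qed
    qed
    then show ?thesis
      using 4 by auto
  qed
  then show ?thesis
    by (simp only: n_def m_def r_def)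
qed

end
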